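(* Let $M$ be a timelike surface in $\mathbb{R}^{2,1}$ with a canonical null direction with respect to a constant vector $Z$. Then $M$ can be locally parametrized as $$\psi(x,y)=\alpha(x)+y\,T_0,$$ where $\alpha$ is a lightlike curve in $\mathbb{R}^{2,1}$, $T_0$ is a constant lightlike vector, and $\alpha'(x)$ and $T_0$ are linearly independent for every $x$.
   Context: $\mathbb{R}^{2,1}$ is $\mathbb{R}^{3}$ with the metric $-dx_1^2+dx_2^2+dx_3^2$. A surface is timelike if the induced metric has signature $(1,1)$; a vector $v$ is lightlike if $v\ne0$ and $\langle v,v\rangle=0$; a curve is lightlike if its velocity is lightlike everywhere. For a constant vector $Z$, $Z=Z^\top+Z^\perp$ along $M$; $M$ has a canonical null direction with respect to $Z$ if $Z^\top$ is lightlike everywhere on $M$. *)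

theory Defs
  imports "HOL-Analysis.Analysis"
begin

type_synonym R3 = "real^3"

definition lor :: "R3 \<Rightarrow> R3 \<Rightarrow> real" where
  "lor x y = - (x$1 * y$1) + x$2 * y$2 + x$3 * y$3"

definition lightlike :: "R3 \<Rightarrow> bool" where
  "lightlike v \<longleftrightarrow> v \<noteq> 0 \<and> lor v v = 0"

fun Ck_on :: "nat \<Rightarrow> 'a::euclidean_space set \<Rightarrow> ('a \<Rightarrow> 'b::real_normed_vector) \<Rightarrow> bool" where
  "Ck_on 0 U f \<longleftrightarrow> continuous_on U f"
| "Ck_on (Suc k) U f \<longleftrightarrow> (\<forall>x\<in>U. f differentiable (at x)) \<and>
      (\<forall>i\<in>Basis. Ck_on k U (\<lambda>x. frechet_derivative f (at x) i))"

definition smooth_on :: "'a::euclidean_space set \<Rightarrow> ('a \<Rightarrow> 'b::real_normed_vector) \<Rightarrow> bool" where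
  "smooth_on U f \<longleftrightarrow> open U \<and> (\<forall>k. Ck_on k U f)"

definition chart :: "R3 set \<Rightarrow> (real \<times> real) set \<Rightarrow> (real \<times> real \<Rightarrow> R3) \<Rightarrow> bool" where
  "chart M U \<phi> \<longleftrightarrow> smooth_on U \<phi> \<and>
     (\<forall>q\<in>U. inj (frechet_derivative \<phi> (at q))) \<and>
     (\<exists>g. homeomorphism U (\<phi> ` U) \<phi> g) \<and>
     \<phi> ` U \<subseteq> M \<and> openin (top_of_set M) (\<phi> ` U)"

definition regular_surface :: "R3 set \<Rightarrow> bool" where
  "regular_surface M \<longleftrightarrow> (\<forall>p\<in>M. \<exists>U \<phi>. chart M U \<phi> \<and> p \<in> \<phi> ` U)"

text \<open>Tangent plane T_pM: image of the differential of a local parametrization at p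
  (independent of the chosen parametrization).\<close>
definition tangent_plane :: "R3 set \<Rightarrow> R3 \<Rightarrow> R3 set" where
  "tangent_plane M p =
     (let (U, \<phi>) = (SOME (U, \<phi>). chart M U \<phi> \<and> p \<in> \<phi> ` U)
      in range (frechet_derivative \<phi> (at (inv_into U \<phi> p))))"

definition signature_1_1 :: "R3 set \<Rightarrow> bool" where
  "signature_1_1 W \<longleftrightarrow> (\<exists>a b. W = span {a, b} \<and>
      lor a a = -1 \<and> lor b b = 1 \<and> lor a b = 0)"

definition timelike_surface :: "R3 set \<Rightarrow> bool" where
  "timelike_surface M \<longleftrightarrow> regular_surface M \<and>
     (\<forall>p\<in>M. signature_1_1 (tangent_plane M p))"

definition tang_part :: "R3 set \<Rightarrow> R3 \<Rightarrow> R3" where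
  "tang_part W Z = (THE v. v \<in> W \<and> (\<forall>w\<in>W. lor (Z - v) w = 0))"

definition canonical_null_direction :: "R3 set \<Rightarrow> R3 \<Rightarrow> bool" where
  "canonical_null_direction M Z \<longleftrightarrow>
     (\<forall>p\<in>M. lightlike (tang_part (tangent_plane M p) Z))"

end

(* The tangential part T of Z is null and orthogonal to Z, because lor Z T = lor T T = 0. The null
   vectors orthogonal to the nonzero vector Z span at most two lines, and a tangent plane contains
   only one of them, since otherwise it would be orthogonal to Z and T would vanish. Containing a
   given line is a closed condition on the point, so the null line is locally a constant line
   spanned by some T0. Taking x = lor T0 p and the T0-component b of p as local coordinates, the
   surface is a cylinder beta(x) + b T0 with lor T0 beta' = 1, and alpha = beta + k T0 is a null
   curve as soon as k' = - lor beta' beta' / 2. *)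
theory Submission
  imports Defs
begin

section \<open>Smooth maps\<close>

text \<open>Two obstacles lie outside the geometry. \<open>tangent_plane\<close> evaluates a chart
  picked by \<open>SOME\<close>, with no relation between the choices at neighbouring points, so
  planes cannot be compared until they are known to be the same in every chart. And the inverse
  function theorem is used for an inverse that is merely differentiable; smoothness of the base
  curve comes from the fact that the inverse, restricted to a coordinate line, solves an autonomous
  differential equation with smooth right-hand side.

  No derivative of the tangential part is taken. The closed condition is applied to the competing
  null line orthogonal to \<open>Z\<close>, if there is one: it is missing from the plane at the
  base point, hence from all nearby planes, and only the first line is left to them.

  Nullity of \<open>T0\<close> is used twice more. It makes \<open>lor T0\<close> constant along the
  rulings, and it removes the quadratic term of the condition that \<alpha>' is null, which thereby
  becomes linear in k' and is solved by one integration.\<close>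

lemma Ck_on_cong:
  assumes "open U" "\<And>x. x \<in> U \<Longrightarrow> f x = g x" "Ck_on k U f"
  shows "Ck_on k U g"
  using assms(2,3)
proof (induction k arbitrary: f g)
  case 0
  then show ?case by (metis Ck_on.simps(1) continuous_on_eq)
next
  case (Suc k)
  have D: "(g has_derivative frechet_derivative f (at x)) (at x)" if "x \<in> U" for x
  proof (rule has_derivative_transform_within_open[OF _ assms(1) that])
    show "(f has_derivative frechet_derivative f (at x)) (at x)"
      using Suc.prems(2) that by (simp flip: frechet_derivative_works)
  qed (rule Suc.prems(1))
  have eq: "frechet_derivative f (at x) = frechet_derivative g (at x)" if "x \<in> U" for x
    using D[OF that] by (rule frechet_derivative_at)
  have "Ck_on k U (\<lambda>x. frechet_derivative g (at x) i)" if "i \<in> Basis" for i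
    by (rule Suc.IH[of "\<lambda>x. frechet_derivative f (at x) i"]) (use Suc.prems(2) that eq in auto)
  then show ?case
    using D by (auto simp: differentiable_def)
qed

text \<open>Admits a derivative given by a formula in place of \<open>frechet_derivative\<close>, so
  that each closure property reduces to a differentiation rule and an induction over k.\<close>

lemma Ck_on_SucI:
  assumes "open U" "\<And>x. x \<in> U \<Longrightarrow> (f has_derivative f' x) (at x)"
    and "\<And>i. i \<in> Basis \<Longrightarrow> Ck_on k U (\<lambda>x. f' x i)"
  shows "Ck_on (Suc k) U f"
proof -
  have "f' x = frechet_derivative f (at x)" if "x \<in> U" for x
    using assms(2)[OF that] by (rule frechet_derivative_at)
  then have "Ck_on k U (\<lambda>x. frechet_derivative f (at x) i)" if "i \<in> Basis" for i
    by (intro Ck_on_cong[OF assms(1) _ assms(3)[OF that]]) simp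
  then show ?thesis
    using assms(2) by (auto simp: differentiable_def)
qed

lemma Ck_on_SucD: "Ck_on (Suc k) U f \<Longrightarrow> Ck_on k U f"
proof (induction k arbitrary: f)
  case 0
  then show ?case
    by (auto intro!: continuous_at_imp_continuous_on differentiable_imp_continuous_within)
next
  case (Suc k)
  then show ?case by (metis Ck_on.simps(2))
qed

lemma Ck_on_has_derivative:
  "Ck_on (Suc k) U f \<Longrightarrow> x \<in> U \<Longrightarrow> (f has_derivative frechet_derivative f (at x)) (at x)"
  using frechet_derivative_works by auto

lemma Ck_on_const: "open U \<Longrightarrow> Ck_on k U (\<lambda>x. c)"
proof (induction k arbitrary: c)
  case (Suc k)
  show ?case
    by (rule Ck_on_SucI[OF Suc.prems has_derivative_const]) (simp add: Suc)
qed auto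

lemma Ck_on_add: "open U \<Longrightarrow> Ck_on k U f \<Longrightarrow> Ck_on k U g \<Longrightarrow> Ck_on k U (\<lambda>x. f x + g x)"
proof (induction k arbitrary: f g)
  case (Suc k)
  show ?case
    by (rule Ck_on_SucI[OF Suc.prems(1)
          has_derivative_add[OF Suc.prems(2,3)[THEN Ck_on_has_derivative]]]) (use Suc in auto)
qed (simp add: continuous_on_add)

lemma (in bounded_linear) Ck_on: "open U \<Longrightarrow> Ck_on k U g \<Longrightarrow> Ck_on k U (\<lambda>x. f (g x))"
proof (induction k arbitrary: g)
  case 0
  then show ?case by (auto intro: continuous_on)
next
  case (Suc k)
  show ?case
    by (rule Ck_on_SucI[OF Suc.prems(1) has_derivative[OF Ck_on_has_derivative[OF Suc.prems(2)]]])
      (use Suc in auto)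
qed

lemma (in bounded_bilinear) Ck_on:
  "open U \<Longrightarrow> Ck_on k U f \<Longrightarrow> Ck_on k U g \<Longrightarrow> Ck_on k U (\<lambda>x. prod (f x) (g x))"
proof (induction k arbitrary: f g)
  case 0
  then show ?case by (auto intro: continuous_on)
next
  case (Suc k)
  \<comment> \<open>Each summand of the product rule leaves one factor undifferentiated, and this
    factor has to be lowered from class \<open>Suc k\<close> to class \<open>k\<close>.\<close>
  show ?case
    by (rule Ck_on_SucI[OF Suc.prems(1)
          FDERIV[OF Suc.prems(2,3)[THEN Ck_on_has_derivative]]])
      (use Suc Ck_on_SucD[OF Suc.prems(2)] Ck_on_SucD[OF Suc.prems(3)] in
        \<open>auto intro!: Ck_on_add\<close>)
qed

section \<open>Closure properties of smooth maps\<close>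

lemma smooth_onI:
  "open U \<Longrightarrow> (\<And>k. Ck_on k U f) \<Longrightarrow> smooth_on U f"
  by (simp add: smooth_on_def)

lemma smooth_on_has_derivative:
  "smooth_on U f \<Longrightarrow> x \<in> U \<Longrightarrow> (f has_derivative frechet_derivative f (at x)) (at x)"
  unfolding smooth_on_def using Ck_on_has_derivative by blast

lemma smooth_on_open: "smooth_on U f \<Longrightarrow> open U"
  by (simp add: smooth_on_def)

lemma smooth_on_continuous: "smooth_on U f \<Longrightarrow> continuous_on U f"
  unfolding smooth_on_def using Ck_on.simps(1) by blast

lemma smooth_on_partial:
  "smooth_on U f \<Longrightarrow> i \<in> Basis \<Longrightarrow> smooth_on U (\<lambda>x. frechet_derivative f (at x) i)"
  unfolding smooth_on_def using Ck_on.simps(2) by blast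

lemma smooth_on_derivI:
  assumes "open U" "\<And>x. x \<in> U \<Longrightarrow> (f has_derivative f' x) (at x)"
    and "\<And>i. i \<in> Basis \<Longrightarrow> smooth_on U (\<lambda>x. f' x i)"
  shows "smooth_on U f"
proof (rule smooth_onI[OF assms(1)])
  fix k
  show "Ck_on k U f"
    by (rule Ck_on_SucD, rule Ck_on_SucI[OF assms(1,2)]) (use assms(3) in \<open>auto simp: smooth_on_def\<close>)
qed

lemma Ck_on_subset: "Ck_on k U f \<Longrightarrow> V \<subseteq> U \<Longrightarrow> Ck_on k V f"
  by (induction k arbitrary: f) (simp add: continuous_on_subset, simp add: subset_iff)

lemma smooth_on_subset: "smooth_on U f \<Longrightarrow> V \<subseteq> U \<Longrightarrow> open V \<Longrightarrow> smooth_on V f"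
  by (simp add: smooth_on_def Ck_on_subset[of _ U])

lemma smooth_on_const: "open U \<Longrightarrow> smooth_on U (\<lambda>x. c)"
  by (simp add: smooth_on_def Ck_on_const)

lemma smooth_on_add: "smooth_on U f \<Longrightarrow> smooth_on U g \<Longrightarrow> smooth_on U (\<lambda>x. f x + g x)"
  by (simp add: smooth_on_def Ck_on_add)

lemma smooth_on_sum:
  "open U \<Longrightarrow> (\<And>i. i \<in> I \<Longrightarrow> smooth_on U (f i)) \<Longrightarrow> smooth_on U (\<lambda>x. \<Sum>i\<in>I. f i x)"
  by (induction I rule: infinite_finite_induct) (auto intro: smooth_on_const smooth_on_add)

lemma (in bounded_linear) smooth_on: "smooth_on U g \<Longrightarrow> smooth_on U (\<lambda>x. f (g x))"
  by (simp add: smooth_on_def Ck_on)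

lemma (in bounded_bilinear) smooth_on:
  "smooth_on U f \<Longrightarrow> smooth_on U g \<Longrightarrow> smooth_on U (\<lambda>x. prod (f x) (g x))"
  by (simp add: smooth_on_def Ck_on)

lemmas smooth_on_mult = bounded_bilinear.smooth_on[OF bounded_bilinear_mult]
  and smooth_on_scaleR = bounded_bilinear.smooth_on[OF bounded_bilinear_scaleR]
  and smooth_on_minus = bounded_linear.smooth_on[OF bounded_linear_minus[OF bounded_linear_ident]]

text \<open>The derivative of 1/f contains 1/f again, next to derivatives of f. With f smooth, class
  k of 1/f is therefore enough for class \<open>Suc k\<close>.\<close>

lemma Ck_on_inverse:
  fixes f :: "'a::euclidean_space \<Rightarrow> real"
  assumes f: "smooth_on U f" and nz: "\<And>x. x \<in> U \<Longrightarrow> f x \<noteq> 0"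
  shows "Ck_on k U (\<lambda>x. inverse (f x))"
proof (induction k)
  case 0
  then show ?case
    using smooth_on_continuous[OF f] nz by (auto intro: continuous_on_inverse)
next
  case (Suc k)
  have U: "open U" using f by (rule smooth_on_open)
  show ?case
  proof (rule Ck_on_SucI[OF U])
    show "((\<lambda>x. inverse (f x)) has_derivative
        (\<lambda>h. - (inverse (f x) * frechet_derivative f (at x) h * inverse (f x)))) (at x)"
      if "x \<in> U" for x
      using Deriv.has_derivative_inverse[OF nz[OF that] smooth_on_has_derivative[OF f that]] .
    show "Ck_on k U (\<lambda>x. - (inverse (f x) * frechet_derivative f (at x) i * inverse (f x)))"
      if "i \<in> Basis" for i
      using smooth_on_partial[OF f that] Suc U unfolding smooth_on_def
      by (intro bounded_linear.Ck_on[OF bounded_linear_minus[OF bounded_linear_ident]]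
          bounded_bilinear.Ck_on[OF bounded_bilinear_mult]) auto
  qed
qed

lemma smooth_on_inverse:
  fixes f :: "'a::euclidean_space \<Rightarrow> real"
  assumes "smooth_on U f" "\<And>x. x \<in> U \<Longrightarrow> f x \<noteq> 0"
  shows "smooth_on U (\<lambda>x. inverse (f x))"
  using Ck_on_inverse[OF assms] assms(1) by (auto simp: smooth_on_def)

section \<open>Smoothness of compositions with projections and curves\<close>

text \<open>Serves to view a curve as a function of two variables. A basis direction of the product
  either is killed by \<open>fst\<close>, with derivative zero, or is mapped to a basis direction of
  the first factor.\<close>

lemma Ck_on_fst:
  fixes f :: "'a::euclidean_space \<Rightarrow> 'c::real_normed_vector"
    and U :: "('a \<times> 'b::euclidean_space) set"
  assumes "open U" "open V" "fst ` U \<subseteq> V"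
  shows "Ck_on k V f \<Longrightarrow> Ck_on k U (\<lambda>p. f (fst p))"
proof (induction k arbitrary: f)
  case 0
  then show ?case
    using continuous_on_compose2[OF _ continuous_on_fst[OF continuous_on_id], of V f U] assms(3)
    by simp
next
  case (Suc k)
  have lin: "linear (frechet_derivative f (at x))" if "x \<in> V" for x
    using Ck_on_has_derivative[OF Suc.prems that] has_derivative_linear by blast
  show ?case
  proof (rule Ck_on_SucI[OF assms(1)])
    fix p assume p: "p \<in> U"
    then have "fst p \<in> V" using assms(3) by blast
    from has_derivative_compose[OF has_derivative_fst[OF has_derivative_ident]
        Ck_on_has_derivative[OF Suc.prems this]]
    show "((\<lambda>p. f (fst p)) has_derivative (\<lambda>h. frechet_derivative f (at (fst p)) (fst h))) (at p)" .
  next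
    fix i :: "'a \<times> 'b" assume "i \<in> Basis"
    then consider "fst i = 0" | "fst i \<in> Basis"
      by (auto simp: Basis_prod_def)
    then show "Ck_on k U (\<lambda>p. frechet_derivative f (at (fst p)) (fst i))"
    proof cases
      case 1
      show ?thesis
      proof (rule Ck_on_cong[OF assms(1) _ Ck_on_const[OF assms(1), where c=0]])
        fix p assume "p \<in> U"
        then have "fst p \<in> V" using assms(3) by blast
        then show "0 = frechet_derivative f (at (fst p)) (fst i)"
          using 1 linear_0[OF lin] by simp
      qed
    next
      case 2
      then show ?thesis using Suc by auto
    qed
  qed
qed

lemma smooth_on_fst:
  fixes U :: "('a::euclidean_space \<times> 'b::euclidean_space) set"
  shows "open U \<Longrightarrow> smooth_on V f \<Longrightarrow> fst ` U \<subseteq> V \<Longrightarrow> smooth_on U (\<lambda>p. f (fst p))"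
  by (auto simp: smooth_on_def intro: Ck_on_fst)

lemma smooth_on_snd:
  fixes U :: "('a::euclidean_space \<times> 'b::euclidean_space) set"
  assumes "open U"
  shows "smooth_on U snd"
  by (rule smooth_on_derivI[OF assms has_derivative_snd[OF has_derivative_ident]])
    (rule smooth_on_const[OF assms])

text \<open>A bootstrap from mere differentiability of \<gamma>: along an integral curve of w, the
  derivative of f is the derivative of f in direction w, evaluated on the same curve. That function
  is again smooth on S, so the induction over k, with f arbitrary, closes.\<close>

lemma smooth_on_integral_curve:
  fixes \<gamma> :: "real \<Rightarrow> 'a::euclidean_space" and f :: "'a \<Rightarrow> 'b::real_normed_vector"
  assumes I: "open I" and \<gamma>S: "\<And>t. t \<in> I \<Longrightarrow> \<gamma> t \<in> S"
    and \<gamma>: "\<And>t. t \<in> I \<Longrightarrow> (\<gamma> has_vector_derivative w (\<gamma> t)) (at t)"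
    and w: "smooth_on S w" and f: "smooth_on S f"
  shows "smooth_on I (\<lambda>t. f (\<gamma> t))"
proof -
  have S: "open S" using f by (rule smooth_on_open)
  have "Ck_on k I (\<lambda>t. f (\<gamma> t))" for k
    using f
  proof (induction k arbitrary: f)
    case 0
    have "continuous_on I \<gamma>"
      using \<gamma> by (meson continuous_at_imp_continuous_on has_vector_derivative_continuous)
    then show ?case
      using continuous_on_compose2[OF smooth_on_continuous[OF 0]] \<gamma>S by auto
  next
    case (Suc k)
    \<comment> \<open>The derivative of f along the field w, expanded in partial derivatives so that
      its smoothness follows from closure properties.\<close>
    let ?L = "\<lambda>q. \<Sum>i\<in>Basis. (w q \<bullet> i) *\<^sub>R frechet_derivative f (at q) i"
    have L: "smooth_on S ?L"
      by (intro smooth_on_sum smooth_on_scaleR smooth_on_partial Suc.prems S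
          bounded_linear.smooth_on[OF bounded_linear_inner_left] w)
    show ?case
    proof (rule Ck_on_SucI[OF I])
      fix t assume t: "t \<in> I"
      have D: "(f has_derivative frechet_derivative f (at (\<gamma> t))) (at (\<gamma> t))"
        using smooth_on_has_derivative[OF Suc.prems] \<gamma>S t by blast
      then interpret D: bounded_linear "frechet_derivative f (at (\<gamma> t))"
        by (rule has_derivative_bounded_linear)
      have "frechet_derivative f (at (\<gamma> t)) (w (\<gamma> t)) = ?L (\<gamma> t)"
        by (subst euclidean_representation[of "w (\<gamma> t)", symmetric])
          (simp add: D.sum D.scaleR del: euclidean_representation)
      then show "((\<lambda>t. f (\<gamma> t)) has_derivative (\<lambda>h. h *\<^sub>R ?L (\<gamma> t))) (at t)"
        using has_derivative_compose[OF \<gamma>[OF t, unfolded has_vector_derivative_def] D]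
        by (simp add: D.scaleR)
    next
      show "Ck_on k I (\<lambda>t. i *\<^sub>R ?L (\<gamma> t))" if "i \<in> Basis" for i :: real
        using Suc.IH[OF L] that by simp
    qed
  qed
  then show ?thesis using I by (rule smooth_onI[rotated])
qed

section \<open>Chart independence of the tangent plane\<close>

text \<open>The transition map between the charts is only known to be continuous, so its derivative
  cannot be used. Instead, secants: a straight line through q in direction w is carried to a path
  \<tau> in V that tends to r. The difference quotients of \<phi> along the line tend to v and are
  close to images under the differential of \<theta>. Hence v lies in the closure of a subspace,
  which is closed.\<close>

lemma range_frechet_derivative_subset:
  assumes \<phi>: "chart M U \<phi>" and \<theta>: "chart M V \<theta>" and q: "q \<in> U" and r: "r \<in> V" and eq: "\<phi> q = \<theta> r"
  shows "range (frechet_derivative \<phi> (at q)) \<subseteq> range (frechet_derivative \<theta> (at r))"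
proof
  fix v assume "v \<in> range (frechet_derivative \<phi> (at q))"
  then obtain w where v: "v = frechet_derivative \<phi> (at q) w" by blast
  let ?D = "frechet_derivative \<theta> (at r)"
  have D\<phi>: "(\<phi> has_derivative frechet_derivative \<phi> (at q)) (at q)"
    and D\<theta>: "(\<theta> has_derivative ?D) (at r)"
    using \<phi> \<theta> q r smooth_on_has_derivative unfolding chart_def by blast+
  interpret D: linear ?D using D\<theta> by (rule has_derivative_linear)
  have "inj ?D" using \<theta> r by (auto simp: chart_def)
  then obtain c where c: "c > 0" "\<And>x. c * norm x \<le> norm (?D x)"
    using linear_inj_bounded_below_pos D.linear_axioms by blast
  obtain h where h: "homeomorphism V (\<theta> ` V) \<theta> h" using \<theta> by (auto simp: chart_def)
  \<comment> \<open>The image of \<theta> is open relative to M only. The path of \<phi> enters it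
    because the path stays in M and eventually lies in the ambient open set
    \<open>W\<close>.\<close>
  obtain W where W: "open W" "\<theta> ` V = M \<inter> W" using \<theta> by (auto simp: chart_def openin_open)
  have line: "((\<lambda>t. q + t *\<^sub>R w) \<longlongrightarrow> q) (at 0)"
    by (rule tendsto_eq_intros refl | simp)+
  have \<phi>t: "((\<lambda>t. \<phi> (q + t *\<^sub>R w)) \<longlongrightarrow> \<phi> q) (at 0)"
    by (rule isCont_tendsto_compose[OF has_derivative_continuous[OF D\<phi>] line])
  have inU: "\<forall>\<^sub>F t in at 0. q + t *\<^sub>R w \<in> U"
    using topological_tendstoD[OF line] \<phi> q by (auto simp: chart_def smooth_on_def)
  have inV: "\<forall>\<^sub>F t in at 0. \<phi> (q + t *\<^sub>R w) \<in> \<theta> ` V"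
  proof -
    have "\<phi> q \<in> W" using eq r W by blast
    from topological_tendstoD[OF \<phi>t W(1) this] inU show ?thesis
      by eventually_elim (use \<phi> W in \<open>auto simp: chart_def\<close>)
  qed
  define \<tau> where "\<tau> = (\<lambda>t. h (\<phi> (q + t *\<^sub>R w)))"
  have \<tau>: "(\<tau> \<longlongrightarrow> r) (at 0)"
  proof -
    have "(\<tau> \<longlongrightarrow> h (\<phi> q)) (at 0)"
      unfolding \<tau>_def using h eq r
      by (intro continuous_on_tendsto_compose[OF _ \<phi>t _ inV]) (auto simp: homeomorphism_def)
    then show ?thesis using h r eq by (simp add: homeomorphism_def)
  qed
  have \<theta>\<tau>: "\<forall>\<^sub>F t in at 0. \<theta> (\<tau> t) = \<phi> (q + t *\<^sub>R w)"
    using inV by eventually_elim (use h in \<open>auto simp: homeomorphism_def \<tau>_def\<close>)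
  have "(\<phi> \<circ> (\<lambda>t. q + t *\<^sub>R w) has_derivative (\<lambda>t. t *\<^sub>R v)) (at 0)"
  proof -
    have "((\<lambda>t. q + t *\<^sub>R w) has_derivative (\<lambda>t. t *\<^sub>R w)) (at 0)"
      by (auto intro!: derivative_eq_intros)
    from diff_chain_at[OF this, of \<phi> "frechet_derivative \<phi> (at q)"] D\<phi>
    have "(\<phi> \<circ> (\<lambda>t. q + t *\<^sub>R w) has_derivative frechet_derivative \<phi> (at q) \<circ> (\<lambda>t. t *\<^sub>R w)) (at 0)"
      by simp
    then show ?thesis
      using linear_scale[OF has_derivative_linear[OF D\<phi>]] by (simp add: v comp_def)
  qed
  note D\<phi>t = this[unfolded has_derivative_at_alt]
  have "v \<in> closure (range ?D)"
    unfolding closure_approachable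
  proof (intro allI impI)
    fix e :: real assume e: "e > 0"
    \<comment> \<open>Let s be the increment of \<tau> and x that of \<theta>. The bounds \<delta>
      \<le> 1 and \<eta> \<le> c/2 give (c/2) |s| \<le> |x| \<le> |t| (|v| + 1), the error term
      \<eta> |s| being absorbed by c |s|. The other two bounds then make the errors at most (e/4)
      |t| and (e/2) |t|, together below e |t|. The summand 1 in |v| + 1 avoids division by zero when
      v = 0.\<close>
    define \<delta> where "\<delta> = min 1 (e / 4)"
    define \<eta> where "\<eta> = min (c / 2) (c * e / (4 * (norm v + 1)))"
    have v1: "norm v + 1 > 0" using norm_ge_zero[of v] by linarith
    have pos: "\<delta> > 0" "\<eta> > 0" using e c v1 by (auto simp: \<delta>_def \<eta>_def)
    have ev1: "\<forall>\<^sub>F t in at 0. norm (\<phi> (q + t *\<^sub>R w) - \<phi> q - t *\<^sub>R v) \<le> \<delta> * \<bar>t\<bar>"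
    proof -
      obtain d where "d > 0" "\<And>t. norm t < d \<Longrightarrow> norm (\<phi> (q + t *\<^sub>R w) - \<phi> q - t *\<^sub>R v) \<le> \<delta> * \<bar>t\<bar>"
        using D\<phi>t pos(1) by force
      then show ?thesis unfolding eventually_at by (auto intro!: exI[of _ d])
    qed
    have ev2: "\<forall>\<^sub>F t in at 0. norm (\<theta> (\<tau> t) - \<theta> r - ?D (\<tau> t - r)) \<le> \<eta> * norm (\<tau> t - r)"
    proof -
      obtain d where d: "d > 0" "\<And>s. norm (s - r) < d \<Longrightarrow> norm (\<theta> s - \<theta> r - ?D (s - r)) \<le> \<eta> * norm (s - r)"
        using D\<theta>[unfolded has_derivative_at_alt] pos(2) by blast
      show ?thesis
        using tendstoD[OF \<tau> d(1)] by eventually_elim (use d(2) in \<open>simp add: dist_norm\<close>)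
    qed
    have near: "\<exists>y\<in>range ?D. dist y v < e"
      if t: "t \<noteq> 0" and 1: "norm (\<phi> (q + t *\<^sub>R w) - \<phi> q - t *\<^sub>R v) \<le> \<delta> * \<bar>t\<bar>"
        and 2: "norm (\<theta> (\<tau> t) - \<theta> r - ?D (\<tau> t - r)) \<le> \<eta> * norm (\<tau> t - r)"
        and 3: "\<theta> (\<tau> t) = \<phi> (q + t *\<^sub>R w)" for t :: real
    proof -
      define s where "s = \<tau> t - r"
      define x where "x = \<theta> (\<tau> t) - \<theta> r"
      have x1: "norm (x - t *\<^sub>R v) \<le> \<delta> * \<bar>t\<bar>" using 1 3 eq by (simp add: x_def)
      have x2: "norm (x - ?D s) \<le> \<eta> * norm s" using 2 by (simp add: x_def s_def)
      have "norm x \<le> norm (x - t *\<^sub>R v) + norm (t *\<^sub>R v)"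
        using norm_triangle_sub[of x "t *\<^sub>R v"] by linarith
      moreover have "\<delta> * \<bar>t\<bar> \<le> 1 * \<bar>t\<bar>" unfolding \<delta>_def by (intro mult_right_mono) auto
      ultimately have nx: "norm x \<le> \<bar>t\<bar> * (norm v + 1)" using x1 by (simp add: algebra_simps)
      have "c * norm s \<le> norm x + norm (x - ?D s)"
        using c(2)[of s] norm_triangle_sub[of "?D s" x] by (simp add: norm_minus_commute)
      moreover have "\<eta> * norm s \<le> c / 2 * norm s"
        unfolding \<eta>_def by (intro mult_right_mono min.cobounded1 norm_ge_zero)
      ultimately have "c / 2 * norm s \<le> norm x" using x2 by simp
      then have "c / 2 * norm s \<le> \<bar>t\<bar> * (norm v + 1)" using nx by linarith
      then have ns: "norm s \<le> 2 / c * (\<bar>t\<bar> * (norm v + 1))" using c(1) by (simp add: field_simps)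
      have "\<eta> * norm s \<le> c * e / (4 * (norm v + 1)) * (2 / c * (\<bar>t\<bar> * (norm v + 1)))"
        unfolding \<eta>_def using ns c e v1
        by (intro mult_mono min.cobounded2) (auto intro!: divide_nonneg_pos mult_nonneg_nonneg)
      also have "\<dots> = e / 2 * \<bar>t\<bar>"
      proof -
        have "c * e / (4 * N) * (2 / c * (\<bar>t\<bar> * N)) = e / 2 * \<bar>t\<bar>" if "N > 0" for N
          using c(1) that by (simp add: field_simps)
        from this[OF v1] show ?thesis .
      qed
      finally have "norm (x - ?D s) \<le> e / 2 * \<bar>t\<bar>" using x2 by linarith
      moreover have "\<delta> * \<bar>t\<bar> \<le> e / 4 * \<bar>t\<bar>" unfolding \<delta>_def by (intro mult_right_mono) auto
      moreover have "norm (?D s - t *\<^sub>R v) \<le> norm (x - ?D s) + norm (x - t *\<^sub>R v)"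
        using norm_triangle_ineq4[of "x - t *\<^sub>R v" "x - ?D s"] by simp
      ultimately have "norm (?D s - t *\<^sub>R v) \<le> 3 / 4 * e * \<bar>t\<bar>" using x1 by linarith
      also have "\<dots> < e * \<bar>t\<bar>" using t e by simp
      finally have "norm (?D s - t *\<^sub>R v) < e * \<bar>t\<bar>" .
      moreover have "?D s - t *\<^sub>R v = t *\<^sub>R (?D ((1/t) *\<^sub>R s) - v)"
        using t by (simp add: D.scale scaleR_diff_right)
      ultimately have "dist (?D ((1/t) *\<^sub>R s)) v < e" using t by (simp add: dist_norm mult.commute)
      then show "\<exists>y\<in>range ?D. dist y v < e" by blast
    qed
    have "\<forall>\<^sub>F t in at (0::real). t \<noteq> 0" by (simp add: eventually_at_filter)
    then have "\<forall>\<^sub>F t in at (0::real). \<exists>y\<in>range ?D. dist y v < e"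
      using ev1 ev2 \<theta>\<tau> by eventually_elim (rule near)
    then show "\<exists>y\<in>range ?D. dist y v < e"
      using eventually_happens'[OF trivial_limit_at] by blast
  qed
  moreover have "closed (range ?D)"
    by (rule closed_subspace[OF linear_subspace_image[OF D.linear_axioms subspace_UNIV]])
  ultimately show "v \<in> range ?D" by simp
qed

text \<open>Both inclusions of the preceding lemma, applied to the given chart and the one chosen by
  \<open>SOME\<close>. Through this the hypotheses on M become statements about differentials of a
  single chart.\<close>

lemma tangent_plane_eq:
  assumes "chart M U \<phi>" "q \<in> U"
  shows "tangent_plane M (\<phi> q) = range (frechet_derivative \<phi> (at q))"
proof -
  define c where "c = (SOME (U, \<theta>). chart M U \<theta> \<and> \<phi> q \<in> \<theta> ` U)"
  obtain V \<theta> where c: "c = (V, \<theta>)" by (cases c)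
  have "case c of (U, \<theta>) \<Rightarrow> chart M U \<theta> \<and> \<phi> q \<in> \<theta> ` U"
    unfolding c_def by (rule someI[of _ "(U, \<phi>)"]) (use assms in auto)
  then have \<theta>: "chart M V \<theta>" "\<phi> q \<in> \<theta> ` V" by (auto simp: c)
  then have r: "inv_into V \<theta> (\<phi> q) \<in> V" "\<phi> q = \<theta> (inv_into V \<theta> (\<phi> q))"
    by (auto intro: inv_into_into simp: f_inv_into_f)
  have "tangent_plane M (\<phi> q) = range (frechet_derivative \<theta> (at (inv_into V \<theta> (\<phi> q))))"
    unfolding tangent_plane_def c_def[symmetric] c by simp
  then show ?thesis
    using range_frechet_derivative_subset[OF assms(1) \<theta>(1) assms(2) r]
      range_frechet_derivative_subset[OF \<theta>(1) assms(1) r(1) assms(2) r(2)[symmetric]] by simp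
qed

section \<open>Null vectors\<close>

lemma bounded_bilinear_lor: "bounded_bilinear lor"
proof -
  have "bilinear lor"
    by (auto simp: bilinear_def lor_def algebra_simps intro!: linearI)
  then show ?thesis by (simp add: bilinear_conv_bounded_bilinear)
qed

interpretation lor: bounded_bilinear lor
  by (rule bounded_bilinear_lor)

lemma lor_commute: "lor x y = lor y x"
  by (simp add: lor_def)

lemma lightlike_time_component: "lightlike v \<Longrightarrow> v $ 1 \<noteq> 0"
proof
  assume v: "lightlike v" "v $ 1 = 0"
  then have "(v $ 2)\<^sup>2 + (v $ 3)\<^sup>2 = 0" by (simp add: lightlike_def lor_def power2_eq_square)
  then have "v = 0" using v by (simp add: vec_eq_iff forall_3 sum_power2_eq_zero_iff)
  then show False using v by (simp add: lightlike_def)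
qed

text \<open>The combination of S and T without time component is null, because S, T span a totally
  null subspace; but the metric is positive definite on vectors without time component.\<close>

lemma lightlike_orthogonal_imp_parallel:
  assumes "lightlike S" "lightlike T" "lor S T = 0"
  obtains c where "S = c *\<^sub>R T"
proof -
  define v where "v = (T $ 1) *\<^sub>R S - (S $ 1) *\<^sub>R T"
  have "lor v v = 0" using assms
    by (simp add: v_def lor.diff_left lor.diff_right lor.scaleR_left lor.scaleR_right
        lightlike_def lor_commute[of T S])
  moreover have "v $ 1 = 0" by (simp add: v_def)
  ultimately have "v = 0" using lightlike_time_component[of v] by (auto simp: lightlike_def)
  then have "(T $ 1) *\<^sub>R S = (S $ 1) *\<^sub>R T" by (simp add: v_def)
  then have "S = (S $ 1 / T $ 1) *\<^sub>R T"
    using lightlike_time_component[OF assms(2)]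
    by (metis (no_types, lifting) divide_inverse_commute divideR_right scaleR_scaleR)
  then show ?thesis by (rule that)
qed

text \<open>Minus the squared determinant of the three vectors is their Gram determinant, which for
  null vectors is twice the product of the mutual products; so a plane contains at most two null
  directions.\<close>
lemma null_vectors_orthogonal_to_common:
  assumes Z: "Z \<noteq> 0" "lor Z R = 0" "lor Z S = 0" "lor Z T = 0"
    and null: "lor R R = 0" "lor S S = 0" "lor T T = 0"
  shows "lor R S * lor S T * lor T R = 0"
proof -
  define d where "d = R$1 * (S$2 * T$3 - S$3 * T$2) - R$2 * (S$1 * T$3 - S$3 * T$1)
      + R$3 * (S$1 * T$2 - S$2 * T$1)"
  \<comment> \<open>Cramer's rule: orthogonality of Z to R, S, T is a homogeneous linear system with
    determinant d up to sign, and Z is a nonzero solution.\<close>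
  have "Z$1 * d = 0" "Z$2 * d = 0" "Z$3 * d = 0"
    using Z(2-4) unfolding d_def lor_def by algebra+
  then have "d = 0" using Z(1) by (auto simp: vec_eq_iff forall_3)
  moreover have "2 * (lor R S * lor S T * lor T R) = - d\<^sup>2"
    using null unfolding d_def lor_def by algebra
  ultimately show ?thesis by simp
qed

text \<open>\<open>THE\<close> requires existence and uniqueness. Both come from the orthonormal
  basis: orthogonality of Z - v to a and b fixes the coefficients of v, with a minus sign at a
  because a is timelike.\<close>

lemma tang_part:
  assumes "signature_1_1 W"
  shows "tang_part W Z \<in> W" and "\<And>w. w \<in> W \<Longrightarrow> lor (Z - tang_part W Z) w = 0"
proof -
  obtain a b where W: "W = span {a, b}" and ab: "lor a a = -1" "lor b b = 1" "lor a b = 0"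
    using assms by (auto simp: signature_1_1_def)
  have ba: "lor b a = 0" using ab(3) by (simp add: lor_commute)
  have span: "w \<in> W \<longleftrightarrow> (\<exists>s t. w = s *\<^sub>R a + t *\<^sub>R b)" for w
    unfolding W span_breakdown_eq by (auto simp: algebra_simps)
  let ?P = "\<lambda>v. v \<in> W \<and> (\<forall>w\<in>W. lor (Z - v) w = 0)"
  let ?v = "- lor Z a *\<^sub>R a + lor Z b *\<^sub>R b"
  have bil: "lor (x + y) z = lor x z + lor y z" "lor z (x + y) = lor z x + lor z y"
    "lor (x - y) z = lor x z - lor y z" "lor (r *\<^sub>R x) z = r * lor x z" "lor z (r *\<^sub>R x) = r * lor z x"
    for x y z r
    by (auto simp: lor.add_left lor.add_right lor.diff_left lor.scaleR_left lor.scaleR_right)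
  have "?v \<in> W" unfolding span by blast
  moreover have "lor (Z - ?v) w = 0" if "w \<in> W" for w
    using that unfolding span by (auto simp: bil ab ba)
  ultimately have "?P ?v" by blast
  moreover have "v = ?v" if Pv: "?P v" for v
  proof -
    obtain s t where v: "v = s *\<^sub>R a + t *\<^sub>R b" using Pv span by blast
    have "a \<in> W" "b \<in> W" by (auto simp: W span_base)
    then have "lor (Z - v) a = 0" "lor (Z - v) b = 0" using Pv by auto
    then have "s = - lor Z a" "t = lor Z b" unfolding v by (simp_all add: bil ab ba)
    then show ?thesis by (simp add: v)
  qed
  ultimately have "?P (tang_part W Z)"
    unfolding tang_part_def by (rule theI[of ?P])
  then show "tang_part W Z \<in> W" and "\<And>w. w \<in> W \<Longrightarrow> lor (Z - tang_part W Z) w = 0" by auto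
qed

text \<open>In a nondegenerate plane the orthogonal complement of a line is a line, and a null line
  lies in its own complement.\<close>

lemma signature_1_1_null_orthogonal:
  assumes "signature_1_1 W" "T \<in> W" "lightlike T" "w \<in> W" "lor T w = 0"
  obtains c where "w = c *\<^sub>R T"
proof -
  obtain a b where W: "W = span {a, b}" and ab: "lor a a = -1" "lor b b = 1" "lor a b = 0"
    using assms by (auto simp: signature_1_1_def)
  have ba: "lor b a = 0" using ab(3) by (simp add: lor_commute)
  have span: "w \<in> W \<Longrightarrow> \<exists>s t. w = s *\<^sub>R a + t *\<^sub>R b" for w
    unfolding W span_breakdown_eq by (auto simp: algebra_simps)
  obtain x y s t where T: "T = x *\<^sub>R a + y *\<^sub>R b" and w: "w = s *\<^sub>R a + t *\<^sub>R b"
    using span assms by metis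
  have bil: "lor (x + y) z = lor x z + lor y z" "lor z (x + y) = lor z x + lor z y"
    "lor (r *\<^sub>R x) z = r * lor x z" "lor z (r *\<^sub>R x) = r * lor z x" for x y z r
    by (auto simp: lor.add_left lor.add_right lor.scaleR_left lor.scaleR_right)
  have "lor T T = 0" using assms by (simp add: lightlike_def)
  then have xy: "y * y = x * x" unfolding T by (simp add: bil ab ba)
  have st: "y * t = x * s" using assms(5) unfolding T w by (simp add: bil ab ba mult.commute)
  have "x \<noteq> 0" using xy assms(3) by (auto simp: T lightlike_def)
  moreover have "x * t = s * y"
  proof -
    have "x * (x * t) = x * (s * y)" using xy st by algebra
    then show ?thesis using \<open>x \<noteq> 0\<close> by simp
  qed
  ultimately have "s / x * x = s" "s / x * y = t" by (simp_all add: field_simps)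
  then have "w = (s / x) *\<^sub>R T"
    by (metis T w scaleR_add_right scaleR_scaleR)
  then show ?thesis by (rule that)
qed

section \<open>Cross products and membership in a plane\<close>

text \<open>Cramer's rule for T in the basis u, v, n, multiplied by the determinant of that basis,
  which is \<open>n \<bullet> n\<close>; in this form the identity is polynomial.\<close>

lemma cross3_decomposition:
  fixes u v T :: "real^3"
  defines "n \<equiv> cross3 u v"
  shows "(n \<bullet> n) *\<^sub>R T = (cross3 T v \<bullet> n) *\<^sub>R u + (cross3 u T \<bullet> n) *\<^sub>R v + (T \<bullet> n) *\<^sub>R n"
  unfolding n_def vec_eq_iff forall_3
  by (simp add: cross3_def inner_vec_def sum_3; algebra)

lemma linear_real_prod_eq:
  fixes f :: "real \<times> real \<Rightarrow> 'a::real_vector"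
  assumes "linear f"
  shows "f (x, y) = x *\<^sub>R f (1, 0) + y *\<^sub>R f (0, 1)"
proof -
  have "f (x, y) = f (x *\<^sub>R (1, 0) + y *\<^sub>R (0, 1))" by simp
  then show ?thesis by (simp only: linear_add[OF assms] linear_scale[OF assms])
qed

lemma cross3_nonzero:
  fixes f :: "real \<times> real \<Rightarrow> real^3"
  assumes "linear f" "inj f"
  shows "cross3 (f (1, 0)) (f (0, 1)) \<noteq> 0"
proof
  interpret linear f by fact
  let ?u = "f (1, 0)" and ?v = "f (0, 1)"
  assume "cross3 ?u ?v = 0"
  \<comment> \<open>The left side is the double product of v with u x v. By injectivity its
    coefficients vanish, so \<open>?v \<bullet> ?v = 0\<close>.\<close>
  then have "(?v \<bullet> ?v) *\<^sub>R ?u - (?v \<bullet> ?u) *\<^sub>R ?v = 0"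
    using Lagrange[of ?v ?u ?v] by simp
  then have "f (?v \<bullet> ?v, - (?v \<bullet> ?u)) = 0"
    by (simp add: linear_real_prod_eq[OF assms(1), of "?v \<bullet> ?v"])
  moreover have inj0: "x = 0" if "f x = 0" for x
    using that assms linear_injective_0 by blast
  ultimately have "(?v \<bullet> ?v, - (?v \<bullet> ?u)) = 0" by blast
  then have "?v = 0" by (simp add: zero_prod_def)
  then have "(0::real, 1::real) = 0" by (rule inj0)
  then show False by (simp add: zero_prod_def)
qed

text \<open>Turns membership in a tangent plane into the vanishing of an expression that depends
  continuously on the point of the chart.\<close>

lemma mem_range_iff_cross3:
  fixes f :: "real \<times> real \<Rightarrow> real^3"
  assumes "linear f" "inj f"
  shows "T \<in> range f \<longleftrightarrow> T \<bullet> cross3 (f (1, 0)) (f (0, 1)) = 0"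
proof
  interpret linear f by fact
  let ?u = "f (1, 0)" and ?v = "f (0, 1)"
  let ?n = "cross3 ?u ?v"
  note f = linear_real_prod_eq[OF assms(1)]
  show "T \<bullet> ?n = 0" if mem: "T \<in> range f"
  proof -
    obtain x y where "T = f (x, y)" using mem by auto
    then show ?thesis by (simp add: f[of x y] inner_add_left dot_cross_self)
  qed
  assume "T \<bullet> ?n = 0"
  then have "(?n \<bullet> ?n) *\<^sub>R T = f (cross3 T ?v \<bullet> ?n, cross3 ?u T \<bullet> ?n)"
    using cross3_decomposition[of ?u ?v T] by (simp add: f[of "_ \<bullet> _"])
  then have "(?n \<bullet> ?n) *\<^sub>R T \<in> range f" by simp
  moreover have "?n \<bullet> ?n \<noteq> 0" using cross3_nonzero[OF assms] by simp
  ultimately show "T \<in> range f"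
    using subspace_scale[OF linear_subspace_image[OF assms(1) subspace_UNIV], of "(?n \<bullet> ?n) *\<^sub>R T" "inverse (?n \<bullet> ?n)"]
    by simp
qed

section \<open>The null direction is locally constant\<close>

lemma chart_subset:
  assumes \<phi>: "chart M U \<phi>" and V: "open V" "V \<subseteq> U"
  shows "chart M V \<phi>"
proof -
  obtain g where g: "homeomorphism U (\<phi> ` U) \<phi> g" using \<phi> by (auto simp: chart_def)
  have "openin (top_of_set (\<phi> ` U)) (\<phi> ` V)"
    by (rule homeomorphism_imp_open_map[OF g]) (simp add: V open_subset)
  then have "openin (top_of_set M) (\<phi> ` V)"
    using \<phi> openin_trans by (auto simp: chart_def)
  moreover have "homeomorphism V (\<phi> ` V) \<phi> g"
    using g V(2) by (rule homeomorphism_of_subsets) auto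
  moreover have "\<phi> ` V \<subseteq> M" using \<phi> V(2) unfolding chart_def by blast
  ultimately show ?thesis
    using \<phi> V smooth_on_subset[OF _ V(2,1)] by (auto simp: chart_def)
qed

lemma chart_linear:
  assumes "chart M U \<phi>" "q \<in> U"
  shows "linear (frechet_derivative \<phi> (at q))"
  using assms smooth_on_has_derivative has_derivative_linear unfolding chart_def by blast

text \<open>If Z = 0, the null tangential part would be orthogonal to the whole plane, and the
  timelike basis vector would be a multiple of it.\<close>

lemma tang_part_lightlike_nonzero:
  assumes W: "signature_1_1 W" and T: "lightlike (tang_part W Z)"
  shows "Z \<noteq> 0"
proof
  assume Z: "Z = 0"
  obtain a b where ab: "W = span {a, b}" "lor a a = -1"
    using W by (auto simp: signature_1_1_def)
  then have "a \<in> W" by (simp add: span_base)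
  then have "lor (tang_part W Z) a = 0"
    using tang_part(2)[OF W, of a Z] by (simp add: Z lor.minus_left)
  then obtain c where "a = c *\<^sub>R tang_part W Z"
    using signature_1_1_null_orthogonal[OF W tang_part(1)[OF W] T \<open>a \<in> W\<close>] by blast
  then show False
    using ab(2) T by (simp add: lor.scaleR_left lor.scaleR_right lightlike_def)
qed

text \<open>The length of \<open>T q\<close> may vary with q, so constancy is expressed by
  membership of the one vector \<open>T q0\<close> in the neighbouring planes.\<close>

lemma null_direction_locally_constant:
  assumes M: "timelike_surface M" and Z: "canonical_null_direction M Z"
    and \<phi>: "chart M U \<phi>" and q0: "q0 \<in> U"
  obtains T0 S where "lightlike T0" "open S" "S \<subseteq> U" "q0 \<in> S"
    "\<And>q. q \<in> S \<Longrightarrow> T0 \<in> range (frechet_derivative \<phi> (at q))"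
proof -
  let ?W = "\<lambda>q. range (frechet_derivative \<phi> (at q))"
  define T where "T = (\<lambda>q. tang_part (?W q) Z)"
  have sig: "signature_1_1 (?W q)" and T: "lightlike (T q)" if "q \<in> U" for q
  proof -
    have "\<phi> q \<in> M" using \<phi> that unfolding chart_def by blast
    then show "signature_1_1 (?W q)" "lightlike (T q)"
      using M Z unfolding timelike_surface_def canonical_null_direction_def T_def
        tangent_plane_eq[OF \<phi> that, symmetric] by blast+
  qed
  have TW: "T q \<in> ?W q" and perp: "\<And>w. w \<in> ?W q \<Longrightarrow> lor (Z - T q) w = 0" if "q \<in> U" for q
    using tang_part[OF sig[OF that]] by (auto simp: T_def)
  have ZT: "lor Z (T q) = 0" if "q \<in> U" for q
    using perp[OF that TW[OF that]] T[OF that] by (simp add: lor.diff_left lightlike_def)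
  have Z0: "Z \<noteq> 0"
    using tang_part_lightlike_nonzero[OF sig[OF q0]] T[OF q0] by (simp add: T_def)
  have sub: "subspace (?W q)" if "q \<in> U" for q
    by (rule linear_subspace_image[OF chart_linear[OF \<phi> that] subspace_UNIV])
  have mem: "R \<in> ?W q" if "q \<in> U" "lightlike R" "lor R (T q) = 0" for R q
    using lightlike_orthogonal_imp_parallel[OF that(2) T[OF that(1)] that(3)]
      subspace_scale[OF sub TW] that(1) by metis
  \<comment> \<open>The question is whether a second null line orthogonal to Z exists. If not, every
    \<open>T q\<close> is orthogonal to \<open>T q0\<close>, and the whole chart domain will
    do.\<close>
  show ?thesis
  proof (cases "\<exists>T1. lightlike T1 \<and> lor Z T1 = 0 \<and> lor (T q0) T1 \<noteq> 0")
    case True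
    then obtain T1 where T1: "lightlike T1" "lor Z T1 = 0" "lor (T q0) T1 \<noteq> 0" by blast
    let ?n = "\<lambda>q. T1 \<bullet> cross3 (frechet_derivative \<phi> (at q) (1, 0)) (frechet_derivative \<phi> (at q) (0, 1))"
    have smooth: "smooth_on U \<phi>" using \<phi> by (simp add: chart_def)
    have "continuous_on U ?n"
      by (intro continuous_on_inner continuous_on_const continuous_on_cross
          smooth_on_continuous[OF smooth_on_partial[OF smooth]]) (auto simp: Basis_prod_def)
    then have "open (U \<inter> ?n -` (- {0}))"
      using smooth_on_open[OF smooth] by (intro continuous_open_preimage) auto
    also have "U \<inter> ?n -` (- {0}) = {q \<in> U. T1 \<notin> ?W q}"
      using mem_range_iff_cross3[OF chart_linear[OF \<phi>], of _ T1] \<phi> by (auto simp: chart_def)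
    finally have "open {q \<in> U. T1 \<notin> ?W q}" .
    \<comment> \<open>A tangent vector orthogonal to Z is also orthogonal to the tangential part of
      Z, which T1 is not.\<close>
    moreover have "T1 \<notin> ?W q0"
    proof
      assume "T1 \<in> ?W q0"
      from perp[OF q0 this] T1 show False by (simp add: lor.diff_left)
    qed
    \<comment> \<open>Among the three null vectors \<open>T q0\<close>, T1, \<open>T q\<close>
      orthogonal to Z some pair is orthogonal; the two pairs involving T1 are excluded.\<close>
    moreover have "T q0 \<in> ?W q" if q: "q \<in> U" and nmem: "T1 \<notin> ?W q" for q
    proof -
      have "lor T1 (T q) \<noteq> 0" using mem[OF q T1(1)] nmem by blast
      moreover have "lor (T q0) T1 * lor T1 (T q) * lor (T q) (T q0) = 0"
        using T T1(1) q q0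
        by (intro null_vectors_orthogonal_to_common[OF Z0 ZT T1(2) ZT]) (auto simp: lightlike_def)
      ultimately have "lor (T q0) (T q) = 0" using T1(3) by (simp add: lor_commute)
      then show ?thesis using mem q T q0 by blast
    qed
    ultimately show ?thesis using T q0 by (intro that[of "T q0" "{q \<in> U. T1 \<notin> ?W q}"]) auto
  next
    case False
    then have "T q0 \<in> ?W q" if "q \<in> U" for q
      using mem[OF that T[OF q0]] T ZT that by blast
    then show ?thesis
      using T q0 \<phi> by (intro that[of "T q0" U]) (auto simp: chart_def smooth_on_def)
  qed
qed

section \<open>The ruled parametrization\<close>

text \<open>Cramer's rule, stated explicitly because the solution is later needed as a smooth
  function of the coefficients.\<close>

lemma inj_plane_map_det:
  fixes f :: "real \<times> real \<Rightarrow> real \<times> real"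
  assumes "linear f" "inj f"
  defines "d \<equiv> fst (f (1, 0)) * snd (f (0, 1)) - fst (f (0, 1)) * snd (f (1, 0))"
  shows "d \<noteq> 0" and "f (snd (f (0, 1)) / d, - snd (f (1, 0)) / d) = (1, 0)"
proof -
  obtain a b c e where f1: "f (1, 0) = (a, b)" and f2: "f (0, 1) = (c, e)" by fastforce
  have f: "f (x, y) = (x * a + y * c, x * b + y * e)" for x y
    unfolding linear_real_prod_eq[OF assms(1), of x y] f1 f2 by simp
  have inj: "x = 0 \<and> y = 0" if "f (x, y) = (0, 0)" for x y
    using linear_injective_0[OF assms(1)] assms(2) that by (auto simp: zero_prod_def)
  have d: "d = a * e - c * b" by (simp add: d_def f1 f2)
  show "d \<noteq> 0"
  proof
    assume "d = 0"
    then have "f (e, - b) = (0, 0)" "f (c, - a) = (0, 0)"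
      using d by (auto simp: f algebra_simps)
    then have "a = 0" "b = 0" using inj by fastforce+
    then have "f (1, 0) = (0, 0)" by (simp add: f1)
    then show False using inj[of 1 0] by simp
  qed
  then have "(e / d) * a + (- b / d) * c = 1" "(e / d) * b + (- b / d) * e = 0"
    using d by (simp_all add: field_simps)
  then show "f (snd (f (0, 1)) / d, - snd (f (1, 0)) / d) = (1, 0)"
    unfolding f1 f2 by (simp only: f snd_conv)
qed

lemma antiderivative_on_ball:
  fixes m :: "real \<Rightarrow> real"
  assumes "continuous_on (cball a r) m"
  obtains k where "\<And>x. x \<in> ball a r \<Longrightarrow> (k has_vector_derivative m x) (at x)"
proof -
  obtain k where k: "\<And>x. x \<in> {a - r..a + r} \<Longrightarrow> (k has_vector_derivative m x) (at x within {a - r..a + r})"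
    using antiderivative_continuous[of "a - r" "a + r" m] assms by (auto simp: cball_eq_atLeastAtMost)
  have "(k has_vector_derivative m x) (at x)" if "x \<in> ball a r" for x
  proof -
    have "x \<in> interior {a - r..a + r}" using that by (simp add: ball_eq_greaterThanLessThan)
    then show ?thesis using k[of x] by (metis at_within_interior interior_subset subsetD)
  qed
  then show ?thesis by (rule that)
qed

text \<open>\<beta> is supplied on the ball of radius 2r so that its velocity is continuous on the
  closed ball of radius r, where an antiderivative will be taken. \<open>G\<close> records the
  covered part of the given chart, from which openness in M is inherited later.\<close>

lemma local_straightening:
  assumes \<phi>: "chart M U \<phi>" and q0: "q0 \<in> U" and T0: "lightlike T0"
    and sig: "\<And>q. q \<in> U \<Longrightarrow> signature_1_1 (range (frechet_derivative \<phi> (at q)))"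
    and T0\<phi>: "\<And>q. q \<in> U \<Longrightarrow> T0 \<in> range (frechet_derivative \<phi> (at q))"
  obtains a0 r \<beta> G J b0 B where "smooth_on (ball a0 (2 * r)) \<beta>"
    "r > 0" "open G" "G \<subseteq> U" "q0 \<in> G" "open J" "b0 \<in> J" "bounded_linear B" "B T0 = 1"
    "(\<lambda>(x, b). \<beta> x + (b - b0) *\<^sub>R T0) ` (ball a0 r \<times> J) = \<phi> ` G"
    "\<And>x. x \<in> ball a0 (2 * r) \<Longrightarrow> lor T0 (\<beta> x) = x \<and> B (\<beta> x) = b0"
proof -
  \<comment> \<open>The Euclidean component: as \<open>T0\<close> is null, \<open>lor T0\<close>
    cannot measure displacement along it.\<close>
  define B where "B = (\<lambda>v. (T0 \<bullet> v) / (T0 \<bullet> T0))"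
  define \<pi> where "\<pi> = (\<lambda>v. (lor T0 v, B v))"
  have T0nz: "T0 \<noteq> 0" and T0null: "lor T0 T0 = 0" using T0 by (auto simp: lightlike_def)
  have B: "bounded_linear B"
    unfolding B_def divide_inverse
    by (intro bounded_linear_mult_left[THEN bounded_linear_compose] bounded_linear_inner_right)
  have BT: "B T0 = 1" using T0nz by (simp add: B_def)
  have \<pi>: "bounded_linear \<pi>"
    unfolding \<pi>_def by (rule bounded_linear_Pair[OF lor.bounded_linear_right B])
  have \<pi>T: "\<pi> T0 = (0, 1)" by (simp add: \<pi>_def T0null BT)
  have smooth: "smooth_on U \<phi>" using \<phi> by (simp add: chart_def)
  have U: "open U" using smooth by (rule smooth_on_open)
  let ?D = "\<lambda>q. frechet_derivative \<phi> (at q)"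
  let ?E = "\<lambda>q h. \<pi> (?D q h)"
  have D: "(\<phi> has_derivative ?D q) (at q)" if "q \<in> U" for q
    using smooth_on_has_derivative[OF smooth that] .
  have E: "((\<lambda>q. \<pi> (\<phi> q)) has_derivative ?E q) (at q)" if "q \<in> U" for q
    using bounded_linear.has_derivative[OF \<pi> D[OF that]] .
  have Elin: "bounded_linear (?E q)" if "q \<in> U" for q
    using E[OF that] by (rule has_derivative_bounded_linear)
  \<comment> \<open>A tangent vector killed by \<open>lor T0\<close> is a multiple of
    \<open>T0\<close>, and \<open>B\<close> then forces the factor to be zero.\<close>
  have Einj: "inj (?E q)" if q: "q \<in> U" for q
  proof -
    have linE: "linear (?E q)" using Elin[OF q] by (rule bounded_linear.linear)
    have "h = 0" if h: "?E q h = 0" for h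
    proof -
      have "lor T0 (?D q h) = 0" "B (?D q h) = 0" using h by (auto simp: \<pi>_def zero_prod_def)
      moreover obtain c where c: "?D q h = c *\<^sub>R T0"
        using signature_1_1_null_orthogonal[OF sig[OF q] T0\<phi>[OF q] T0 rangeI, of h] calculation(1) by blast
      ultimately have "c = 0"
        using BT bounded_linear.linear[OF B, THEN linear_scale, of c T0] by simp
      then have "?D q h = 0" using c by simp
      then show "h = 0"
        using \<phi> q linear_injective_0[OF chart_linear[OF \<phi> q]] unfolding chart_def by blast
    qed
    then show ?thesis by (simp add: linear_injective_0[OF linE])
  qed
  obtain invf where invf: "linear invf" "invf \<circ> ?E q0 = id"
    using linear_injective_left_inverse[OF bounded_linear.linear[OF Elin[OF q0]] Einj[OF q0]] by blast
  obtain U' V g g' where "open U'" and U': "U' \<subseteq> U" "q0 \<in> U'" and V: "open V" "\<pi> (\<phi> q0) \<in> V"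
    and hom: "homeomorphism U' V (\<lambda>q. \<pi> (\<phi> q)) g"
    and dg: "\<And>y. y \<in> V \<Longrightarrow> (g has_derivative g' y) (at y)"
    and g': "\<And>y. y \<in> V \<Longrightarrow> g' y = inv (blinfun_apply (Blinfun (?E (g y))))"
  proof (rule inverse_function_theorem[of U "\<lambda>q. \<pi> (\<phi> q)" "\<lambda>q. Blinfun (?E q)" q0 "Blinfun invf"])
    show "((\<lambda>q. \<pi> (\<phi> q)) has_derivative blinfun_apply (Blinfun (?E q))) (at q)" if "q \<in> U" for q
      using E[OF that] by (simp add: bounded_linear_Blinfun_apply[OF Elin[OF that]])
    show "continuous_on U (\<lambda>q. Blinfun (?E q))"
    proof (rule continuous_on_blinfun_componentwise)
      fix i :: "real \<times> real" assume i: "i \<in> Basis"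
      have "continuous_on U (\<lambda>q. ?E q i)"
        by (rule bounded_linear.continuous_on[OF \<pi> smooth_on_continuous[OF smooth_on_partial[OF smooth i]]])
      then show "continuous_on U (\<lambda>q. blinfun_apply (Blinfun (?E q)) i)"
        by (rule continuous_on_eq) (simp add: bounded_linear_Blinfun_apply[OF Elin])
    qed
    show "Blinfun invf o\<^sub>L Blinfun (?E q0) = id_blinfun"
      using invf(1) pointfree_idE[OF invf(2)] by (intro blinfun_eqI)
        (simp add: bounded_linear_Blinfun_apply[OF Elin[OF q0]]
          bounded_linear_Blinfun_apply linear_conv_bounded_linear)
  qed (use U q0 in auto)
  have gV: "g y \<in> U" "\<pi> (\<phi> (g y)) = y" if "y \<in> V" for y
    using hom that U'(1) by (auto simp: homeomorphism_def)
  have dg': "(g has_derivative inv (?E (g y))) (at y)" if "y \<in> V" for y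
    using dg[OF that] g'[OF that] by (simp add: bounded_linear_Blinfun_apply[OF Elin[OF gV(1)[OF that]]])
  obtain A' J' where AJ: "open A'" "open J'" "\<pi> (\<phi> q0) \<in> A' \<times> J'" "A' \<times> J' \<subseteq> V"
    using V by (rule open_prod_elim)
  define a0 where "a0 = lor T0 (\<phi> q0)"
  define b0 where "b0 = B (\<phi> q0)"
  have "a0 \<in> A'" "b0 \<in> J'" using AJ(3) by (auto simp: a0_def b0_def \<pi>_def)
  then obtain e e' where "e > 0" and e: "ball a0 e \<subseteq> A'" and "e' > 0" and e': "ball b0 e' \<subseteq> J'"
    using AJ(1,2) by (meson openE)
  define r where "r = e / 2"
  define J where "J = ball b0 e'"
  have "r > 0" using \<open>e > 0\<close> by (simp add: r_def)
  have b0J: "b0 \<in> J" using \<open>e' > 0\<close> by (simp add: J_def)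
  have inV: "(x, b) \<in> V" if "x \<in> ball a0 (2 * r)" "b \<in> J" for x b
  proof -
    have "x \<in> A'" "b \<in> J'" using that e e' by (auto simp: r_def J_def)
    then show ?thesis using AJ(4) by blast
  qed
  have invE: "inv (?E q) y = h" if "q \<in> U" "?E q h = y" for q h y
    using inv_f_eq[OF Einj[OF that(1)] that(2)] .
  define \<beta> where "\<beta> = (\<lambda>x. \<phi> (g (x, b0)))"
  have \<pi>\<beta>: "\<pi> (\<beta> x) = (x, b0)" if "x \<in> ball a0 (2 * r)" for x
    using gV(2)[OF inV[OF that b0J]] by (simp add: \<beta>_def)
  define d where "d = (\<lambda>q. fst (?E q (1, 0)) * snd (?E q (0, 1)) - fst (?E q (0, 1)) * snd (?E q (1, 0)))"
  \<comment> \<open>The velocity field of the curves x \<mapsto> g (x, b): its image under the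
    differential of \<pi> \<circ> \<phi> is (1, 0). The explicit quotients make it smooth in
    q.\<close>
  define w where "w = (\<lambda>q. (snd (?E q (0, 1)) / d q, - snd (?E q (1, 0)) / d q))"
  have d: "d q \<noteq> 0" and w: "?E q (w q) = (1, 0)" if "q \<in> U" for q
    using inj_plane_map_det[OF bounded_linear.linear[OF Elin[OF that]] Einj[OF that]]
    unfolding d_def w_def by auto
  have smoothE: "smooth_on U (\<lambda>q. fst (?E q i))" "smooth_on U (\<lambda>q. snd (?E q i))" if "i \<in> Basis" for i
    using bounded_linear.smooth_on[OF lor.bounded_linear_right smooth_on_partial[OF smooth that]]
      bounded_linear.smooth_on[OF B smooth_on_partial[OF smooth that]]
    by (auto simp: \<pi>_def)
  have basis: "(1, 0) \<in> (Basis :: (real \<times> real) set)" "(0, 1) \<in> (Basis :: (real \<times> real) set)"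
    by (auto simp: Basis_prod_def)
  have "smooth_on U (\<lambda>q. fst (?E q (1, 0)) * snd (?E q (0, 1)) + - (fst (?E q (0, 1)) * snd (?E q (1, 0))))"
    by (intro smooth_on_add smooth_on_minus smooth_on_mult smoothE basis)
  then have smoothd: "smooth_on U d" by (simp add: d_def)
  have "smooth_on U (\<lambda>q. (snd (?E q (0, 1)) * inverse (d q)) *\<^sub>R (1::real, 0::real) +
      (- snd (?E q (1, 0)) * inverse (d q)) *\<^sub>R (0, 1))"
    by (intro smooth_on_add smooth_on_scaleR smooth_on_minus smooth_on_mult smoothE basis
        smooth_on_inverse[OF smoothd d] smooth_on_const U)
  then have smoothw: "smooth_on U w" by (simp add: w_def divide_inverse)
  have smooth\<beta>: "smooth_on (ball a0 (2 * r)) \<beta>"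
    unfolding \<beta>_def
  proof (rule smooth_on_integral_curve[OF open_ball _ _ smoothw smooth])
    fix x assume "x \<in> ball a0 (2 * r)"
    then have y: "(x, b0) \<in> V" using inV b0J by blast
    show "g (x, b0) \<in> U" by (rule gV(1)[OF y])
    have "((\<lambda>x. (x, b0)) has_derivative (\<lambda>h. (h, 0))) (at x)"
      by (intro has_derivative_Pair has_derivative_ident has_derivative_const)
    from has_derivative_compose[OF this dg'[OF y]]
    have "((\<lambda>x. g (x, b0)) has_derivative (\<lambda>h. inv (?E (g (x, b0))) (h, 0))) (at x)" .
    moreover have "inv (?E (g (x, b0))) (h, 0) = h *\<^sub>R w (g (x, b0))" for h
    proof (rule invE[OF gV(1)[OF y]])
      show "?E (g (x, b0)) (h *\<^sub>R w (g (x, b0))) = (h, 0)"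
        using linear_scale[OF bounded_linear.linear[OF Elin[OF gV(1)[OF y]]], of h] w[OF gV(1)[OF y]]
        by simp
    qed
    ultimately show "((\<lambda>x. g (x, b0)) has_vector_derivative w (g (x, b0))) (at x)"
      by (simp add: has_vector_derivative_def)
  qed
  \<comment> \<open>\<open>T0\<close> is tangent and \<pi> maps it to (0, 1), so the b-derivative of
    \<phi> (g (x, b)) is \<open>T0\<close>; the difference to the straight line is constant on the
    ball \<open>J\<close>.\<close>
  have ruled: "\<phi> (g (x, b)) = \<beta> x + (b - b0) *\<^sub>R T0" if x: "x \<in> ball a0 (2 * r)" and b: "b \<in> J" for x b
  proof -
    have "((\<lambda>b. \<phi> (g (x, b)) - (b - b0) *\<^sub>R T0) has_derivative (\<lambda>h. 0)) (at b within J)"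
      if "b \<in> J" for b
    proof -
      have y: "(x, b) \<in> V" using inV x that by blast
      have gU: "g (x, b) \<in> U" by (rule gV(1)[OF y])
      have "((\<lambda>b. (x, b)) has_derivative (\<lambda>h. (0, h))) (at b)"
        by (intro has_derivative_Pair has_derivative_ident has_derivative_const)
      from has_derivative_compose[OF has_derivative_compose[OF this dg'[OF y]] D[OF gU]]
      have D1: "((\<lambda>b. \<phi> (g (x, b))) has_derivative
          (\<lambda>h. ?D (g (x, b)) (inv (?E (g (x, b))) (0, h)))) (at b)" .
      obtain s where s: "T0 = ?D (g (x, b)) s" using T0\<phi>[OF gU] by blast
      have "?D (g (x, b)) (inv (?E (g (x, b))) (0, h)) = h *\<^sub>R T0" for h
      proof -
        have "?E (g (x, b)) (h *\<^sub>R s) = (0, h)"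
          using linear_scale[OF bounded_linear.linear[OF Elin[OF gU]], of h s] \<pi>T s by simp
        then have "inv (?E (g (x, b))) (0, h) = h *\<^sub>R s" by (rule invE[OF gU])
        then show ?thesis using linear_scale[OF chart_linear[OF \<phi> gU], of h s] s by simp
      qed
      with D1 have "((\<lambda>b. \<phi> (g (x, b))) has_derivative (\<lambda>h. h *\<^sub>R T0)) (at b within J)"
        by (simp add: has_derivative_at_withinI)
      then show ?thesis by (auto intro!: derivative_eq_intros)
    qed
    then obtain c where "\<And>b. b \<in> J \<Longrightarrow> \<phi> (g (x, b)) - (b - b0) *\<^sub>R T0 = c"
      using has_derivative_zero_constant[of J "\<lambda>b. \<phi> (g (x, b)) - (b - b0) *\<^sub>R T0"] by (auto simp: J_def)
    from this[OF b] this[OF b0J] show ?thesis by (simp add: \<beta>_def algebra_simps)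
  qed
  define G where "G = U' \<inter> (\<lambda>q. \<pi> (\<phi> q)) -` (ball a0 r \<times> J)"
  have "open G" unfolding G_def
    using hom \<open>open U'\<close> by (intro continuous_open_preimage)
      (auto simp: homeomorphism_def J_def open_Times)
  moreover have "q0 \<in> G"
    using U'(2) \<open>r > 0\<close> b0J by (simp add: G_def \<pi>_def a0_def b0_def)
  moreover have "(\<lambda>(x, b). \<beta> x + (b - b0) *\<^sub>R T0) ` (ball a0 r \<times> J) = \<phi> ` G"
  proof -
    have small: "x \<in> ball a0 (2 * r)" if "x \<in> ball a0 r" for x
      using that \<open>r > 0\<close> by auto
    have "g ` (ball a0 r \<times> J) = G"
    proof
      show "g ` (ball a0 r \<times> J) \<subseteq> G"
        using hom inV small gV(2) by (fastforce simp: G_def homeomorphism_def)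
      show "G \<subseteq> g ` (ball a0 r \<times> J)"
        using hom by (force simp: G_def homeomorphism_def)
    qed
    moreover have "(\<lambda>(x, b). \<beta> x + (b - b0) *\<^sub>R T0) ` (ball a0 r \<times> J) = \<phi> ` g ` (ball a0 r \<times> J)"
      unfolding image_image using ruled small by (intro image_cong) auto
    ultimately show ?thesis by simp
  qed
  ultimately show ?thesis
    using U'(1) \<open>r > 0\<close> b0J B BT smooth\<beta> \<pi>\<beta>
    by (intro that[of a0 r \<beta> G J b0 B]) (auto simp: G_def J_def \<pi>_def)
qed

theorem mainTheorem10:
  fixes M :: "R3 set" and Z :: R3
  assumes "timelike_surface M"
    and "canonical_null_direction M Z"
  shows "\<forall>p\<in>M. \<exists>U (\<alpha> :: real \<Rightarrow> R3) (T0 :: R3).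
           chart M U (\<lambda>(x, y). \<alpha> x + y *\<^sub>R T0) \<and>
           p \<in> (\<lambda>(x, y). \<alpha> x + y *\<^sub>R T0) ` U \<and>
           smooth_on (fst ` U) \<alpha> \<and>
           lightlike T0 \<and>
           (\<forall>x\<in>fst ` U. lightlike (vector_derivative \<alpha> (at x))) \<and>
           (\<forall>x\<in>fst ` U. \<forall>c d. c *\<^sub>R vector_derivative \<alpha> (at x) + d *\<^sub>R T0 = 0
                \<longrightarrow> c = 0 \<and> d = 0)"
proof
  fix p assume "p \<in> M"
  then obtain U \<phi> q0 where \<phi>U: "chart M U \<phi>" and q0U: "q0 \<in> U" and p: "p = \<phi> q0"
    using assms(1) unfolding timelike_surface_def regular_surface_def by blast
  obtain T0 S where T0: "lightlike T0" and S: "open S" "S \<subseteq> U" "q0 \<in> S"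
    and T0S: "\<And>q. q \<in> S \<Longrightarrow> T0 \<in> range (frechet_derivative \<phi> (at q))"
    using null_direction_locally_constant[OF assms \<phi>U q0U] by blast
  have \<phi>: "chart M S \<phi>" using chart_subset[OF \<phi>U S(1,2)] .
  have sig: "signature_1_1 (range (frechet_derivative \<phi> (at q)))" if "q \<in> S" for q
  proof -
    have "\<phi> q \<in> M" using \<phi> that unfolding chart_def by blast
    then show ?thesis
      using assms(1) tangent_plane_eq[OF \<phi> that] by (auto simp: timelike_surface_def)
  qed
  obtain a0 r \<beta> G J b0 B where smooth\<beta>: "smooth_on (ball a0 (2 * r)) \<beta>"
    and r: "r > 0" and G: "open G" "G \<subseteq> S" "q0 \<in> G" and J: "open J" "b0 \<in> J"
    and B: "bounded_linear B" "B T0 = 1"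
    and image: "(\<lambda>(x, b). \<beta> x + (b - b0) *\<^sub>R T0) ` (ball a0 r \<times> J) = \<phi> ` G"
    and \<beta>: "\<And>x. x \<in> ball a0 (2 * r) \<Longrightarrow> lor T0 (\<beta> x) = x \<and> B (\<beta> x) = b0"
    by (rule local_straightening[OF \<phi> S(3) T0]) (rule sig, assumption, rule T0S, assumption, rule that)
  have T0null: "lor T0 T0 = 0" and T0nz: "T0 \<noteq> 0" using T0 by (auto simp: lightlike_def)
  define I where "I = ball a0 r"
  have I: "open I" "a0 \<in> I" and I2: "cball a0 r \<subseteq> ball a0 (2 * r)" "I \<subseteq> ball a0 (2 * r)"
    using r by (auto simp: I_def)
  define \<beta>' where "\<beta>' = (\<lambda>x. frechet_derivative \<beta> (at x) 1)"
  have smooth\<beta>': "smooth_on (ball a0 (2 * r)) \<beta>'"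
    unfolding \<beta>'_def by (rule smooth_on_partial[OF smooth\<beta>]) simp
  have d\<beta>: "(\<beta> has_vector_derivative \<beta>' x) (at x)" if "x \<in> ball a0 (2 * r)" for x
  proof -
    note D = smooth_on_has_derivative[OF smooth\<beta> that]
    have "frechet_derivative \<beta> (at x) = (\<lambda>h. h *\<^sub>R \<beta>' x)"
    proof
      show "frechet_derivative \<beta> (at x) h = h *\<^sub>R \<beta>' x" for h
        using linear_scale[OF has_derivative_linear[OF D], of h 1] by (simp add: \<beta>'_def)
    qed
    then show ?thesis using D by (simp add: has_vector_derivative_def)
  qed
  have T0\<beta>': "lor T0 (\<beta>' x) = 1" if "x \<in> ball a0 (2 * r)" for x
  proof -
    have "((\<lambda>x. lor T0 (\<beta> x)) has_vector_derivative lor T0 (\<beta>' x)) (at x)"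
      by (rule bounded_linear.has_vector_derivative[OF lor.bounded_linear_right d\<beta>[OF that]])
    then have "((\<lambda>x. x) has_vector_derivative lor T0 (\<beta>' x)) (at x)"
      by (rule has_vector_derivative_transform_within_open[OF _ open_ball that]) (simp add: \<beta>)
    then show ?thesis
      by (rule vector_derivative_unique_at[OF _ has_vector_derivative_id])
  qed
  \<comment> \<open>The cross term contributes twice \<open>m x\<close>, since
    \<open>lor T0 (\<beta>' x) = 1\<close>; hence the factor 1/2.\<close>
  define m where "m = (\<lambda>x. (- 1 / 2) *\<^sub>R lor (\<beta>' x) (\<beta>' x))"
  have smoothm: "smooth_on (ball a0 (2 * r)) m"
    unfolding m_def
    by (intro smooth_on_scaleR smooth_on_const open_ball lor.smooth_on smooth\<beta>')
  obtain k where k: "\<And>x. x \<in> I \<Longrightarrow> (k has_vector_derivative m x) (at x)"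
    using antiderivative_on_ball[OF continuous_on_subset[OF smooth_on_continuous[OF smoothm] I2(1)]]
    unfolding I_def by blast
  have smoothk: "smooth_on I k"
    by (rule smooth_on_derivI[OF I(1) k[unfolded has_vector_derivative_def]], assumption)
      (intro smooth_on_scaleR smooth_on_const I smooth_on_subset[OF smoothm I2(2)])
  define \<alpha> where "\<alpha> = (\<lambda>x. \<beta> x + k x *\<^sub>R T0)"
  define \<alpha>' where "\<alpha>' = (\<lambda>x. \<beta>' x + m x *\<^sub>R T0)"
  have smooth\<alpha>: "smooth_on I \<alpha>"
    unfolding \<alpha>_def
    by (intro smooth_on_add smooth_on_scaleR smooth_on_const I smoothk smooth_on_subset[OF smooth\<beta> I2(2)])
  have d\<alpha>: "(\<alpha> has_vector_derivative \<alpha>' x) (at x)" if "x \<in> I" for x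
    unfolding \<alpha>_def \<alpha>'_def
    using that I2(2)
    by (intro has_vector_derivative_add d\<beta> bounded_linear.has_vector_derivative[OF
          bounded_linear_scaleR_left k]) auto
  have vd: "vector_derivative \<alpha> (at x) = \<alpha>' x" if "x \<in> I" for x
    by (rule vector_derivative_at[OF d\<alpha>[OF that]])
  have T0\<alpha>': "lor T0 (\<alpha>' x) = 1" if "x \<in> I" for x
    using T0\<beta>'[of x] that I2(2) by (auto simp: \<alpha>'_def lor.add_right lor.scaleR_right T0null)
  have null\<alpha>': "lightlike (\<alpha>' x)" if "x \<in> I" for x
  proof -
    have "lor T0 (\<beta>' x) = 1" using T0\<beta>' that I2(2) by blast
    then have "lor (\<alpha>' x) (\<alpha>' x) = 0"
      by (simp add: \<alpha>'_def m_def lor.diff_left lor.diff_right lor.scaleR_left lor.scaleR_right T0null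
          lor_commute[of "\<beta>' x" T0])
    moreover have "\<alpha>' x \<noteq> 0" using T0\<alpha>'[OF that] by (auto simp: lor.zero_right)
    ultimately show ?thesis by (simp add: lightlike_def)
  qed
  have indep: "c = 0 \<and> d = 0" if "x \<in> I" "c *\<^sub>R \<alpha>' x + d *\<^sub>R T0 = 0" for c d x
  proof -
    \<comment> \<open>Pairing with the null vector \<open>T0\<close> removes the second summand and
      reads off c.\<close>
    have "lor T0 (c *\<^sub>R \<alpha>' x + d *\<^sub>R T0) = c"
      using T0\<alpha>'[OF that(1)] by (simp add: lor.add_right lor.scaleR_right T0null)
    then have "c = 0" using that(2) by (simp add: lor.zero_right)
    then show ?thesis using that(2) T0nz by simp
  qed
  define \<psi> where "\<psi> = (\<lambda>(x, y). \<alpha> x + y *\<^sub>R T0)"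
  \<comment> \<open>Passing from \<beta> to \<alpha> shifts each ruling by k x, so y corresponds to
    b = b0 + k x + y. \<open>W\<close> is the sheared image of the rectangle in the coordinates x,
    b.\<close>
  define W where "W = (I \<times> UNIV) \<inter> (\<lambda>q. b0 + k (fst q) + snd q) -` J"
  have "continuous_on (I \<times> UNIV) (\<lambda>q. b0 + k (fst q) + snd q)"
    by (intro continuous_intros continuous_on_compose2[OF smooth_on_continuous[OF smoothk]]) auto
  then have openW: "open W"
    unfolding W_def using I J by (intro continuous_open_preimage open_Times) auto
  have fstW: "fst ` W = I"
  proof
    show "I \<subseteq> fst ` W"
    proof
      fix x assume "x \<in> I"
      \<comment> \<open>This y corresponds to b = b0, the point of \<beta> itself.\<close>
      then have "(x, - k x) \<in> W" using J by (simp add: W_def)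
      then show "x \<in> fst ` W" by force
    qed
  qed (auto simp: W_def)
  have "\<psi> ` W = (\<lambda>(x, b). \<beta> x + (b - b0) *\<^sub>R T0) ` (I \<times> J)"
  proof (intro equalityI subsetI)
    fix v assume "v \<in> \<psi> ` W"
    then obtain x y where "(x, y) \<in> W" "v = \<psi> (x, y)" by auto
    then show "v \<in> (\<lambda>(x, b). \<beta> x + (b - b0) *\<^sub>R T0) ` (I \<times> J)"
      by (intro image_eqI[of _ _ "(x, b0 + k x + y)"])
        (auto simp: W_def \<psi>_def \<alpha>_def scaleR_add_left)
  next
    fix v assume "v \<in> (\<lambda>(x, b). \<beta> x + (b - b0) *\<^sub>R T0) ` (I \<times> J)"
    then obtain x b where "x \<in> I" "b \<in> J" "v = \<beta> x + (b - b0) *\<^sub>R T0" by auto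
    then show "v \<in> \<psi> ` W"
      by (intro image_eqI[of _ _ "(x, b - b0 - k x)"])
        (auto simp: W_def \<psi>_def \<alpha>_def algebra_simps)
  qed
  then have \<psi>W: "\<psi> ` W = \<phi> ` G" using image by (simp add: I_def)
  have "smooth_on W (\<lambda>q. \<alpha> (fst q) + snd q *\<^sub>R T0)"
    by (intro smooth_on_add smooth_on_scaleR smooth_on_const smooth_on_snd openW
        smooth_on_fst[OF _ smooth\<alpha>]) (simp add: fstW)
  then have smooth\<psi>: "smooth_on W \<psi>" by (simp add: \<psi>_def case_prod_beta')
  have inj\<psi>: "inj (frechet_derivative \<psi> (at q))" if "q \<in> W" for q
  proof -
    have q: "fst q \<in> I" using that fstW by blast
    from has_derivative_compose[OF has_derivative_fst[OF has_derivative_ident]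
        d\<alpha>[OF q, unfolded has_vector_derivative_def]]
    have "((\<lambda>q. \<alpha> (fst q)) has_derivative (\<lambda>h. fst h *\<^sub>R \<alpha>' (fst q))) (at q)" .
    then have "((\<lambda>q. \<alpha> (fst q) + snd q *\<^sub>R T0) has_derivative (\<lambda>h. fst h *\<^sub>R \<alpha>' (fst q) + snd h *\<^sub>R T0)) (at q)"
      by (auto intro!: derivative_eq_intros)
    then have D: "(\<psi> has_derivative (\<lambda>h. fst h *\<^sub>R \<alpha>' (fst q) + snd h *\<^sub>R T0)) (at q)"
      by (simp add: \<psi>_def case_prod_beta')
    have "inj (\<lambda>h. fst h *\<^sub>R \<alpha>' (fst q) + snd h *\<^sub>R T0)"
      using linear_injective_0[OF has_derivative_linear[OF D]] indep[OF q]
      by (simp add: prod_eq_iff)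
    then show ?thesis using frechet_derivative_at[OF D] by simp
  qed
  have lor\<psi>: "lor T0 (\<psi> q) = fst q" and B\<psi>: "B (\<psi> q) = b0 + k (fst q) + snd q" if "q \<in> W" for q
  proof -
    have "fst q \<in> ball a0 (2 * r)" using that fstW I2(2) by blast
    then show "lor T0 (\<psi> q) = fst q" "B (\<psi> q) = b0 + k (fst q) + snd q"
      using \<beta>[of "fst q"] B(2) linear_add[OF bounded_linear.linear[OF B(1)]]
        linear_scale[OF bounded_linear.linear[OF B(1)]]
      by (simp_all add: \<psi>_def \<alpha>_def case_prod_beta lor.add_right lor.scaleR_right T0null)
  qed
  \<comment> \<open>Explicit inverse: \<open>lor T0\<close> recovers x, and \<open>B\<close>
    recovers b, from which the shift is subtracted.\<close>
  have "homeomorphism W (\<psi> ` W) \<psi> (\<lambda>v. (lor T0 v, B v - b0 - k (lor T0 v)))"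
  proof (rule homeomorphismI)
    have "(\<lambda>v. lor T0 v) ` (\<psi> ` W) \<subseteq> I" using lor\<psi> fstW by auto
    then show "continuous_on (\<psi> ` W) (\<lambda>v. (lor T0 v, B v - b0 - k (lor T0 v)))"
      by (intro continuous_intros continuous_on_compose2[OF smooth_on_continuous[OF smoothk]]
          bounded_linear.continuous_on[OF lor.bounded_linear_right] bounded_linear.continuous_on[OF B(1)])
  qed (use smooth_on_continuous[OF smooth\<psi>] lor\<psi> B\<psi> in \<open>auto simp: prod_eq_iff\<close>)
  \<comment> \<open>The image of \<psi> is that of the restricted chart, so it is open in M.\<close>
  moreover have "chart M G \<phi>" by (rule chart_subset[OF \<phi> G(1,2)])
  ultimately have chart\<psi>: "chart M W \<psi>"
    using smooth\<psi> inj\<psi> \<psi>W unfolding chart_def by auto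
  have "p \<in> \<psi> ` W" using G(3) p \<psi>W by simp
  then show "\<exists>U (\<alpha> :: real \<Rightarrow> R3) (T0 :: R3).
           chart M U (\<lambda>(x, y). \<alpha> x + y *\<^sub>R T0) \<and>
           p \<in> (\<lambda>(x, y). \<alpha> x + y *\<^sub>R T0) ` U \<and>
           smooth_on (fst ` U) \<alpha> \<and>
           lightlike T0 \<and>
           (\<forall>x\<in>fst ` U. lightlike (vector_derivative \<alpha> (at x))) \<and>
           (\<forall>x\<in>fst ` U. \<forall>c d. c *\<^sub>R vector_derivative \<alpha> (at x) + d *\<^sub>R T0 = 0
                \<longrightarrow> c = 0 \<and> d = 0)"
    using chart\<psi> smooth\<alpha> T0 vd null\<alpha>' indep
    unfolding \<psi>_def by (intro exI[of _ W] exI[of _ \<alpha>] exI[of _ T0]) (auto simp: fstW)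
qed

end
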